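(* Every finite tree has a canonical ESD labeling.
   Context: For a graph $G=(V,E)$ and $l\in\mathbb N$, a vertex labeling $\phi:V\to\{1,\dots,l\}$ is an edge-sum distinguishing (ESD) labeling if $\phi$ is injective and the edge-weights $w_\phi(uv)=\phi(u)+\phi(v)$ are pairwise distinct over all edges $uv\in E$. It is a canonical ESD labeling if $l=|V|$. *)

theory Defs
  imports Main
begin

definition simple_graph :: "'a set \<Rightarrow> 'a set set \<Rightarrow> bool" where
  "simple_graph V E \<longleftrightarrow> (\<forall>e\<in>E. e \<subseteq> V \<and> card e = 2)"

definition is_walk :: "'a set \<Rightarrow> 'a set set \<Rightarrow> 'a list \<Rightarrow> bool" where
  "is_walk V E xs \<longleftrightarrow> xs \<noteq> [] \<and> set xs \<subseteq> V \<and> successively (\<lambda>u v. {u, v} \<in> E) xs"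

definition is_connected :: "'a set \<Rightarrow> 'a set set \<Rightarrow> bool" where
  "is_connected V E \<longleftrightarrow> V \<noteq> {} \<and>
     (\<forall>u\<in>V. \<forall>v\<in>V. \<exists>xs. is_walk V E xs \<and> hd xs = u \<and> last xs = v)"

(* A cycle is given by its distinct vertices in cyclic order; the closing vertex is not repeated. *)
definition is_cycle :: "'a set \<Rightarrow> 'a set set \<Rightarrow> 'a list \<Rightarrow> bool" where
  "is_cycle V E xs \<longleftrightarrow> length xs \<ge> 3 \<and> distinct xs \<and> is_walk V E (xs @ [hd xs])"

definition is_tree :: "'a set \<Rightarrow> 'a set set \<Rightarrow> bool" where
  "is_tree V E \<longleftrightarrow> simple_graph V E \<and> is_connected V E \<and> \<not> (\<exists>xs. is_cycle V E xs)"

(* Summing over the edge as a set gives the sum of the two end labels, see edge_weight_pair. *)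
definition edge_weight :: "('a \<Rightarrow> nat) \<Rightarrow> 'a set \<Rightarrow> nat" where
  "edge_weight \<phi> e = (\<Sum>v\<in>e. \<phi> v)"

lemma edge_weight_pair: "u \<noteq> v \<Longrightarrow> edge_weight \<phi> {u, v} = \<phi> u + \<phi> v"
  by (simp add: edge_weight_def)

(* The value of the labeling outside V is irrelevant. *)
definition esd_labeling :: "'a set \<Rightarrow> 'a set set \<Rightarrow> nat \<Rightarrow> ('a \<Rightarrow> nat) \<Rightarrow> bool" where
  "esd_labeling V E l \<phi> \<longleftrightarrow>
     \<phi> ` V \<subseteq> {1..l} \<and> inj_on \<phi> V \<and> inj_on (edge_weight \<phi>) E"

definition canonical_esd_labeling :: "'a set \<Rightarrow> 'a set set \<Rightarrow> ('a \<Rightarrow> nat) \<Rightarrow> bool" where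
  "canonical_esd_labeling V E \<phi> \<longleftrightarrow> esd_labeling V E (card V) \<phi>"

end

theory Submission
  imports Defs
begin

text \<open>
  Number the vertices in breadth-first order. The parent of a vertex is then numbered no later
  than the parent of any subsequent vertex, so the weights of the edges from a vertex to its parent
  increase strictly with the number of the vertex.
\<close>

lemma successively_crosses:
  assumes "successively P xs" "xs \<noteq> []" "hd xs \<in> S" "last xs \<notin> S"
  shows "\<exists>u\<in>S \<inter> set xs. \<exists>v\<in>set xs - S. P u v"
  using assms
proof (induction xs rule: induct_list012)
  case (3 x y zs)
  show ?case
  proof (cases "y \<in> S")
    case True
    then show ?thesis using 3 by fastforce
  next
    case False
    then show ?thesis using 3 by auto
  qed
qed auto

text \<open>A walk from a vertex of \<open>S\<close> to one outside must leave \<open>S\<close> at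
  some step. This is what lets the search go on while unvisited vertices remain.\<close>

lemma is_connected_crossing_edge:
  assumes "is_connected V E" "S \<subseteq> V" "S \<noteq> {}" "S \<noteq> V"
  obtains u v where "u \<in> S" "v \<in> V - S" "{u, v} \<in> E"
proof -
  obtain a b where ab: "a \<in> S" "b \<in> V" "b \<notin> S"
    using assms by blast
  then obtain xs where xs: "is_walk V E xs" "hd xs = a" "last xs = b"
    using assms unfolding is_connected_def by (meson subsetD)
  then show ?thesis
    using successively_crosses[of "\<lambda>u v. {u, v} \<in> E" xs S] ab that
    unfolding is_walk_def by blast
qed

text \<open>Unlike in \<open>is_connected\<close>, the walks stay inside \<open>S\<close> and repeat
  no vertex, so that a vertex outside \<open>S\<close> adjacent to both ends of one with at least
  two vertices closes it to a cycle. The search maintains this property, hence paths never have to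
  be extracted from walks.\<close>

definition path_connected :: "'a set \<Rightarrow> 'a set set \<Rightarrow> bool" where
  "path_connected S E \<longleftrightarrow>
     (\<forall>u\<in>S. \<forall>v\<in>S. \<exists>xs. is_walk S E xs \<and> distinct xs \<and> hd xs = u \<and> last xs = v)"

lemma is_walk_Cons:
  assumes "is_walk S E xs" "{v, hd xs} \<in> E"
  shows "is_walk (insert v S) E (v # xs)"
  using assms by (auto simp: is_walk_def successively_Cons)

lemma is_walk_snoc:
  assumes "is_walk S E xs" "{last xs, v} \<in> E"
  shows "is_walk (insert v S) E (xs @ [v])"
  using assms by (auto simp: is_walk_def successively_append_iff)

lemma is_walk_mono: "is_walk S E xs \<Longrightarrow> S \<subseteq> T \<Longrightarrow> is_walk T E xs"
  by (auto simp: is_walk_def)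

lemma path_connected_insert:
  assumes S: "path_connected S E" and v: "v \<notin> S" and u: "u \<in> S" "{u, v} \<in> E"
  shows "path_connected (insert v S) E"
  unfolding path_connected_def
proof (intro ballI)
  fix a b assume ab: "a \<in> insert v S" "b \<in> insert v S"
  consider "a = v" "b = v" | "a = v" "b \<in> S" | "a \<in> S" "b = v" | "a \<in> S" "b \<in> S"
    using ab by blast
  then show "\<exists>xs. is_walk (insert v S) E xs \<and> distinct xs \<and> hd xs = a \<and> last xs = b"
  proof cases
    case 1
    then show ?thesis by (intro exI[of _ "[v]"]) (auto simp: is_walk_def)
  next
    case 2
    then obtain xs where "is_walk S E xs" "distinct xs" "hd xs = u" "last xs = b"
      using S u unfolding path_connected_def by blast
    then show ?thesis
      using 2 u v is_walk_Cons[of S E xs v]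
      by (intro exI[of _ "v # xs"]) (auto simp: insert_commute is_walk_def)
  next
    case 3
    then obtain xs where "is_walk S E xs" "distinct xs" "hd xs = a" "last xs = u"
      using S u unfolding path_connected_def by blast
    then show ?thesis
      using 3 u v is_walk_snoc[of S E xs v]
      by (intro exI[of _ "xs @ [v]"]) (auto simp: is_walk_def)
  next
    case 4
    then show ?thesis
      using S is_walk_mono[of S E _ "insert v S"] unfolding path_connected_def by blast
  qed
qed

text \<open>Otherwise a path in \<open>S\<close> from \<open>u\<close> to \<open>w\<close> closes
  through \<open>v\<close> to a cycle. Consequently each newly visited vertex has a single candidate
  for its parent.\<close>

lemma acyclic_unique_neighbour:
  assumes acyc: "\<nexists>xs. is_cycle V E xs" and S: "path_connected S E" "S \<subseteq> V"
    and v: "v \<in> V" "v \<notin> S" and u: "u \<in> S" "{u, v} \<in> E" and w: "w \<in> S" "{w, v} \<in> E"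
  shows "u = w"
proof (rule ccontr)
  assume "u \<noteq> w"
  obtain xs where xs: "is_walk S E xs" "distinct xs" "hd xs = u" "last xs = w"
    using S u w unfolding path_connected_def by blast
  \<comment> \<open>Together with \<open>v\<close> this gives the three vertices that
    \<open>is_cycle\<close> demands.\<close>
  have "length xs \<ge> 2"
    using xs \<open>u \<noteq> w\<close> by (cases xs; cases "tl xs") (auto simp: is_walk_def)
  moreover have "is_walk (insert v (insert v S)) E (v # (xs @ [v]))"
    using xs u w by (intro is_walk_Cons is_walk_snoc) (auto simp: is_walk_def insert_commute)
  then have "is_walk V E ((v # xs) @ [v])"
    using S v by (auto intro: is_walk_mono)
  moreover have "distinct (v # xs)"
    using xs v by (auto simp: is_walk_def)
  ultimately have "is_cycle V E (v # xs)"
    by (simp add: is_cycle_def)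
  with acyc show False by blast
qed

text \<open>
  A state of the search: \<open>S\<close> is the set of visited vertices and \<open>\<phi>\<close> numbers them. The last
  condition says that the vertices numbered before some parent have no unvisited neighbours.
\<close>

definition bfs_numbering :: "'a set set \<Rightarrow> 'a set \<Rightarrow> ('a \<Rightarrow> nat) \<Rightarrow> bool" where
  "bfs_numbering E S \<phi> \<longleftrightarrow> bij_betw \<phi> S {1..card S} \<and>
     (\<forall>u\<in>S. \<forall>v\<in>S. \<forall>x\<in>S. \<forall>y\<in>S. {u, v} \<in> E \<longrightarrow> {x, y} \<in> E \<longrightarrow> \<phi> u < \<phi> v \<longrightarrow> \<phi> x < \<phi> y \<longrightarrow>
        (\<phi> v < \<phi> y \<longrightarrow> \<phi> u \<le> \<phi> x) \<and> (v = y \<longrightarrow> u = x)) \<and>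
     (\<forall>u\<in>S. \<forall>v\<in>S. \<forall>x\<in>S. \<forall>y. y \<notin> S \<longrightarrow> {u, v} \<in> E \<longrightarrow> {x, y} \<in> E \<longrightarrow> \<phi> u < \<phi> v \<longrightarrow> \<phi> u \<le> \<phi> x)"

text \<open>The parent of an edge is simply its lower-numbered end. The new vertex \<open>v\<close>
  gets the largest number, so it only adds the edge with parent \<open>u\<close> and child
  \<open>v\<close>. Earlier parents come no later than \<open>u\<close>, because \<open>u\<close>
  still had the unvisited neighbour \<open>v\<close>; and by \<open>min\<close> no vertex numbered
  before \<open>u\<close> has unvisited neighbours.\<close>

lemma bfs_numbering_insert:
  assumes bfs: "bfs_numbering E S \<phi>" and "finite S" and v: "v \<notin> S"
    and u: "u \<in> S" "{u, v} \<in> E"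
    and min: "\<And>x y. x \<in> S \<Longrightarrow> y \<notin> S \<Longrightarrow> {x, y} \<in> E \<Longrightarrow> \<phi> u \<le> \<phi> x"
    and unique: "\<And>w. w \<in> S \<Longrightarrow> {w, v} \<in> E \<Longrightarrow> w = u"
  shows "bfs_numbering E (insert v S) (\<phi>(v := Suc (card S)))"
proof -
  let ?\<psi> = "\<phi>(v := Suc (card S))"
  have bij: "bij_betw \<phi> S {1..card S}"
    using bfs by (simp add: bfs_numbering_def)
  have old: "?\<psi> x = \<phi> x" "\<phi> x < Suc (card S)" if "x \<in> S" for x
    using that v bij_betwE[OF bij] by (auto simp: less_Suc_eq_le)
  have "bij_betw ?\<psi> S {1..card S}"
    using bij bij_betw_cong[of S ?\<psi> \<phi>] old by blast
  then have "bij_betw ?\<psi> (S \<union> {v}) ({1..card S} \<union> {?\<psi> v})"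
    using v by (intro notIn_Un_bij_betw) auto
  moreover have "{1..card S} \<union> {?\<psi> v} = {1..card (insert v S)}"
    using \<open>finite S\<close> v by auto
  ultimately have 1: "bij_betw ?\<psi> (insert v S) {1..card (insert v S)}"
    by simp
  \<comment> \<open>Read from parent to child, an edge is either an old one or the edge from
    \<open>u\<close> to \<open>v\<close>: the largest number rules out \<open>v\<close> as a parent,
    and \<open>unique\<close> leaves only \<open>u\<close> as its parent.\<close>
  have edge: "a \<in> S \<and> (b \<in> S \<and> \<phi> a < \<phi> b \<or> b = v \<and> a = u)"
    if "a \<in> insert v S" "b \<in> insert v S" "{a, b} \<in> E" "?\<psi> a < ?\<psi> b" for a b
    using that old unique v by (metis insertE fun_upd_same less_asym less_irrefl)
  have 2: "(?\<psi> b < ?\<psi> y \<longrightarrow> ?\<psi> a \<le> ?\<psi> x) \<and> (b = y \<longrightarrow> a = x)"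
    if "a \<in> insert v S" "b \<in> insert v S" "x \<in> insert v S" "y \<in> insert v S"
      "{a, b} \<in> E" "{x, y} \<in> E" "?\<psi> a < ?\<psi> b" "?\<psi> x < ?\<psi> y" for a b x y
  proof -
    note ab = edge[OF that(1,2,5,7)] and xy = edge[OF that(3,4,6,8)]
    consider "b \<in> S" "y \<in> S" | "b \<in> S" "y = v" | "b = v" "y \<in> S" | "b = v" "y = v"
      using ab xy by blast
    then show ?thesis
    proof cases
      case 1
      then have "a \<in> S" "x \<in> S" "\<phi> a < \<phi> b" "\<phi> x < \<phi> y" using ab xy v by auto
      then show ?thesis using bfs 1 that old unfolding bfs_numbering_def by metis
    next
      case 2
      then have "a \<in> S" "x = u" "\<phi> a < \<phi> b" using ab xy v by auto
      \<comment> \<open>The last condition of \<open>bfs_numbering\<close> for \<open>S\<close>,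
        applied to the unvisited neighbour \<open>v\<close> of \<open>u\<close>.\<close>
      moreover from this have "\<phi> a \<le> \<phi> u"
        using bfs 2 that u v unfolding bfs_numbering_def by metis
      ultimately show ?thesis using 2 u v old by auto
    next
      case 3
      \<comment> \<open>Both implications are vacuous: no vertex of \<open>S\<close> is numbered
        after \<open>v\<close> or equal to it.\<close>
      then show ?thesis using old v by fastforce
    next
      case 4
      then show ?thesis using ab xy v by auto
    qed
  qed
  have 3: "?\<psi> a \<le> ?\<psi> x"
    if "a \<in> insert v S" "b \<in> insert v S" "x \<in> insert v S" "y \<notin> insert v S"
      "{a, b} \<in> E" "{x, y} \<in> E" "?\<psi> a < ?\<psi> b" for a b x y
  proof -
    note ab = edge[OF that(1,2,5,7)] and x = that(3)
    consider "x = v" | "x \<in> S" "b \<in> S" "\<phi> a < \<phi> b" | "x \<in> S" "a = u"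
      using x ab by blast
    then show ?thesis
    proof cases
      case 1
      then show ?thesis using ab old[of a] by auto
    next
      case 2
      then have "\<phi> a \<le> \<phi> x" using bfs ab that unfolding bfs_numbering_def by blast
      then show ?thesis using 2 ab old by auto
    next
      case 3
      \<comment> \<open>The vertex \<open>y\<close> was also unvisited before \<open>v\<close> was
        added, so the minimality of \<open>u\<close> applies to \<open>x\<close>.\<close>
      then show ?thesis using min[of x y] that old u by auto
    qed
  qed
  show ?thesis
    unfolding bfs_numbering_def
    by (intro conjI[OF 1 conjI] ballI allI impI) (use 2 3 in blast)+
qed

text \<open>Induction over the steps of the search, which starts at an arbitrary root and visits one
  vertex per step. Path-connectedness is carried along because the uniqueness of the parent depends
  on it.\<close>

lemma tree_bfs_numbering_card:
  assumes "finite V" "is_tree V E" "n < card V"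
  shows "\<exists>S \<phi>. S \<subseteq> V \<and> card S = Suc n \<and> path_connected S E \<and> bfs_numbering E S \<phi>"
  using assms(3)
proof (induction n)
  case 0
  then obtain r where "r \<in> V" by fastforce
  moreover have "{r} \<notin> E"
    using \<open>is_tree V E\<close> by (auto simp: is_tree_def simple_graph_def)
  moreover have "path_connected {r} E"
    unfolding path_connected_def by (auto simp: is_walk_def intro!: exI[of _ "[r]"])
  ultimately show ?case
    by (intro exI[of _ "{r}"] exI[of _ "\<lambda>_. 1"]) (auto simp: bfs_numbering_def bij_betw_def)
next
  case (Suc n)
  then obtain S \<phi> where S: "S \<subseteq> V" "card S = Suc n" "path_connected S E" "bfs_numbering E S \<phi>"
    by auto
  have "finite S"
    using S \<open>finite V\<close> finite_subset by blast
  have tree: "is_connected V E" "\<nexists>xs. is_cycle V E xs" "simple_graph V E"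
    using \<open>is_tree V E\<close> by (auto simp: is_tree_def)
  define boundary where "boundary u \<longleftrightarrow> u \<in> S \<and> (\<exists>v. v \<notin> S \<and> {u, v} \<in> E)" for u
  have "S \<noteq> {}" "S \<noteq> V"
    using S Suc.prems by auto
  then obtain w where "boundary w"
    using is_connected_crossing_edge[OF tree(1) S(1)] unfolding boundary_def by blast
  \<comment> \<open>The lowest-numbered vertex with an unvisited neighbour is the one that a
    breadth-first queue would serve next.\<close>
  then obtain u where u: "boundary u" "\<And>x. boundary x \<Longrightarrow> \<phi> u \<le> \<phi> x"
    using ex_has_least_nat[of boundary w \<phi>] by blast
  then obtain v where v: "u \<in> S" "v \<notin> S" "{u, v} \<in> E"
    unfolding boundary_def by blast
  have "v \<in> V"
    using v tree(3) unfolding simple_graph_def by blast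
  have unique: "w = u" if "w \<in> S" "{w, v} \<in> E" for w
    using acyclic_unique_neighbour[OF tree(2) S(3,1) \<open>v \<in> V\<close>] v that by blast
  have "\<phi> u \<le> \<phi> x" if "x \<in> S" "y \<notin> S" "{x, y} \<in> E" for x y
    using u(2)[of x] that unfolding boundary_def by blast
  from bfs_numbering_insert[OF S(4) \<open>finite S\<close> v(2,1,3) this unique]
  have "bfs_numbering E (insert v S) (\<phi>(v := Suc (card S)))" .
  moreover have "path_connected (insert v S) E"
    using path_connected_insert[OF S(3) v(2,1,3)] .
  moreover have "insert v S \<subseteq> V" "card (insert v S) = Suc (Suc n)"
    using S v \<open>v \<in> V\<close> \<open>finite S\<close> by auto
  ultimately show ?case by blast
qed

lemma tree_bfs_numbering:
  assumes "finite V" "is_tree V E"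
  obtains \<phi> where "bfs_numbering E V \<phi>"
proof -
  have "card V > 0"
    using assms by (auto simp: is_tree_def is_connected_def card_gt_0_iff)
  then obtain S \<phi> where "S \<subseteq> V" "card S = card V" "bfs_numbering E S \<phi>"
    \<comment> \<open>The root is visited at \<open>n = 0\<close>, so this value of \<open>n\<close>
      exhausts \<open>V\<close>.\<close>
    using tree_bfs_numbering_card[OF assms, of "card V - 1"] by auto
  then show ?thesis
    using card_subset_eq[OF assms(1)] that by blast
qed

text \<open>Of two edges with differently numbered children, the one with the smaller child has no
  larger parent, hence a strictly smaller weight. Equal weights therefore force equal children, and
  a child determines its parent.\<close>

lemma bfs_numbering_inj_on_edge_weight:
  assumes "simple_graph V E" "bfs_numbering E V \<phi>"
  shows "inj_on (edge_weight \<phi>) E"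
proof (rule inj_onI)
  have inj: "inj_on \<phi> V"
    using assms(2) by (simp add: bfs_numbering_def bij_betw_def)
  \<comment> \<open>Each edge is oriented from parent to child, as its two ends carry different
    numbers.\<close>
  have edge: "\<exists>u\<in>V. \<exists>v\<in>V. e = {u, v} \<and> \<phi> u < \<phi> v" if e: "e \<in> E" for e
  proof -
    have "e \<subseteq> V" "card e = 2"
      using assms(1) e by (auto simp: simple_graph_def)
    then obtain a b where ab: "e = {a, b}" "a \<noteq> b" "a \<in> V" "b \<in> V"
      by (auto simp: card_2_iff)
    then have "\<phi> a \<noteq> \<phi> b"
      using inj by (auto dest: inj_onD)
    then show ?thesis
      using ab by (metis insert_commute linorder_neqE_nat)
  qed
  fix e f assume e: "e \<in> E" and f: "f \<in> E" and eq: "edge_weight \<phi> e = edge_weight \<phi> f"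
  obtain u v where uv: "u \<in> V" "v \<in> V" "e = {u, v}" "\<phi> u < \<phi> v"
    using edge e by blast
  obtain x y where xy: "x \<in> V" "y \<in> V" "f = {x, y}" "\<phi> x < \<phi> y"
    using edge f by blast
  have sum: "\<phi> u + \<phi> v = \<phi> x + \<phi> y"
    using eq uv xy by (metis edge_weight_pair less_irrefl)
  have "\<phi> v < \<phi> y \<Longrightarrow> \<phi> u \<le> \<phi> x" "\<phi> y < \<phi> v \<Longrightarrow> \<phi> x \<le> \<phi> u" "v = y \<Longrightarrow> u = x"
    using assms(2) uv xy e f unfolding bfs_numbering_def by blast+
  moreover from this have "\<phi> v = \<phi> y"
    using sum by linarith
  then have "v = y"
    using inj uv xy by (auto dest: inj_onD)
  ultimately show "e = f"
    using uv xy by simp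
qed

theorem theorem5:
  fixes V :: "'a set" and E :: "'a set set"
  assumes "finite V" and "is_tree V E"
  shows "\<exists>\<phi>. canonical_esd_labeling V E \<phi>"
proof -
  obtain \<phi> where \<phi>: "bfs_numbering E V \<phi>"
    using tree_bfs_numbering[OF assms] .
  moreover have "inj_on (edge_weight \<phi>) E"
    using bfs_numbering_inj_on_edge_weight[OF _ \<phi>] assms(2) by (simp add: is_tree_def)
  ultimately show ?thesis
    by (auto simp: canonical_esd_labeling_def esd_labeling_def bfs_numbering_def bij_betw_def)
qed

end
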